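(* Let $d$ be a prime number and let $\mathcal{X},\mathcal{Y},\mathcal{B}$ be arbitrary finite non-empty sets. Then $$\mathbb{S}_{\mathrm{St}}^d[\mathcal{X}\to\mathcal{B}\mid\mathcal{Y}]=\mathbb{S}_{\mathrm{C}}^d[\mathcal{X}\to\mathcal{B}\mid\mathcal{Y}],$$ i.e. the set of correlations $p(b|x,y)$ achievable by communicating one $d$-level quantum system from Alice to Bob with stabilizer-limited strategies and shared randomness equals the set of correlations achievable by communicating one $d$-level classical system with shared randomness.
   Context: One-way communication: Alice receives $x\in\mathcal{X}$, Bob receives $y\in\mathcal{Y}$, Alice sends one system to Bob, and Bob outputs $b\in\mathcal{B}$. A correlation is a conditional distribution $\{p(b|x,y)\}_{b\in\mathcal{B},x\in\mathcal{X},y\in\mathcal{Y}}$. Classical strategies. A pure $d$-level classical strategy consists of a function $E:\mathcal{X}\to\{0,\dots,d-1\}$ and functions $D_y:\{0,\dots,d-1\}\to\mathcal{B}$, $y\in\mathcal{Y}$; its correlation is $p(b|x,y)=1$ if $b=D_y(E(x))$ and $0$ otherwise. $\mathbb{S}_{\mathrm{C}}^d[\mathcal{X}\to\mathcal{B}\mid\mathcal{Y}]$ is the set of all correlations obtained with shared randomness, i.e. the convex hull of the correlations of pure $d$-level classical strategies. Stabilizer objects. On $\mathbb{C}^d$ with basis $\{|j\rangle\}_{j\in\mathbb{Z}_d}$ put $X|j\rangle=|j+1 \bmod d\rangle$, $Z|j\rangle=\omega^j|j\rangle$, $\omega=e^{2\pi i/d}$. Put $P_{(a_1,a_2)}=X^{a_1}Z^{a_2}$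 for $d>2$ and $P_{(a_1,a_2)}=i^{a_1a_2}X^{a_1}Z^{a_2}$ for $d=2$ (with $a_1,a_2\in\{0,1\}$). The $d+1$ operators $P_{(0,1)},P_{(1,0)},P_{(1,1)},\dots,P_{(1,d-1)}$ each have the $d$ distinct eigenvalues $\omega^j$, $j\in\mathbb{Z}_d$, and their eigenbases are mutually unbiased. Denote them $P_1,\dots,P_{d+1}$ and let $\psi^j_k$ be the rank-one projector onto the eigenvector of $P_k$ with eigenvalue $\omega^j$. The pure stabilizer states are the $d(d+1)$ projectors $\psi^j_k$ (the Clifford orbit of $|0\rangle\langle 0|$), and the stabilizer states are their convex combinations. Stabilizer-limited strategies. A pure $d$-level stabilizer-limited strategy consists of: a map assigning to each $x\in\mathcal{X}$ a pure stabilizer state $\psi_x\in\{\psi^j_k\}$; a map $y\mapsto k(y)\in\{1,\dots,d+1\}$ choosing for each $y\in\mathcal{Y}$ the projective measurement $\{\psi^j_{k(y)}\}_{j\in\mathbb{Z}_d}$; and post-processing functions $D_y:\mathbb{Z}_d\to\mathcal{B}$. Its correlation is $p(b|x,y)=\sum_{j:\,D_y(j)=b}\operatorname{Tr}(\psi_x\psi^j_{k(y)})$. $\mathbb{S}_{\mathrm{St}}^d[\mathcal{X}\to\mathcal{B}\mid\mathcal{Y}]$ is the set of all correlations obtained with shared randomness, i.e. the convex hull of the correlations of pure $d$-level stabilizer-limited strategies. *)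

theory Defs
  imports
    "HOL-Analysis.Analysis"
    "HOL-Computational_Algebra.Primes"
    "Jordan_Normal_Form.Char_Poly"
begin

(* Operators on C^d are d-by-d matrices over nat indices {0..<d}, representing Z_d.
   Both matrix libraries are in scope; the names vec, mat and $ below refer to
   Jordan_Normal_Form, while real ^ 'n and \<chi> refer to HOL-Analysis. *)

hide_type (open) Finite_Cartesian_Product.vec
hide_const (open) Finite_Cartesian_Product.mat
no_notation vec_nth (infixl \<open>$\<close> 90)

section \<open>Stabilizer states\<close>

definition omega :: "nat \<Rightarrow> complex" where
  "omega d = exp (2 * complex_of_real pi * \<i> / of_nat d)"

definition shift_mat :: "nat \<Rightarrow> complex mat" where
  "shift_mat d = Matrix.mat d d (\<lambda>(i, j). if i = (j + 1) mod d then 1 else 0)"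

definition clock_mat :: "nat \<Rightarrow> complex mat" where
  "clock_mat d = Matrix.mat d d (\<lambda>(i, j). if i = j then omega d ^ j else 0)"

definition pauli :: "nat \<Rightarrow> nat \<times> nat \<Rightarrow> complex mat" where
  "pauli d a = (case a of (a1, a2) \<Rightarrow>
     if d = 2 then \<i> ^ (a1 * a2) \<cdot>\<^sub>m (shift_mat d ^\<^sub>m a1 * clock_mat d ^\<^sub>m a2)
     else shift_mat d ^\<^sub>m a1 * clock_mat d ^\<^sub>m a2)"

(* P_1, ..., P_(d+1) are the operators labelled (0,1), (1,0), (1,1), ..., (1,d-1). *)
definition basis_op :: "nat \<Rightarrow> nat \<Rightarrow> complex mat" where
  "basis_op d k = pauli d (if k = 1 then (0, 1) else (1, k - 2))"

definition ketbra :: "complex Matrix.vec \<Rightarrow> complex mat" where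
  "ketbra v = Matrix.mat (dim_vec v) (dim_vec v) (\<lambda>(i, j). v $ i * cnj (v $ j))"

(* For d prime, k in {1..d+1} and j < d the eigenspace is one-dimensional, so v is unique
   up to a phase, which cancels in ketbra v. *)
definition stab_proj :: "nat \<Rightarrow> nat \<Rightarrow> nat \<Rightarrow> complex mat" where
  "stab_proj d k j =
     (THE M. \<exists>v. eigenvector (basis_op d k) v (omega d ^ j) \<and> v \<bullet>c v = 1 \<and> M = ketbra v)"

definition pure_stab_states :: "nat \<Rightarrow> complex mat set" where
  "pure_stab_states d = {stab_proj d k j | k j. k \<in> {1..d + 1} \<and> j < d}"

definition mat_trace :: "'a::comm_monoid_add mat \<Rightarrow> 'a" where
  "mat_trace A = (\<Sum>i<dim_row A. A $$ (i, i))"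

section \<open>Correlations\<close>

(* p(b|x,y) is the component (b, x, y); this type, unlike a plain function type, is a
   real vector space in the library, so that convex hull applies. *)
type_synonym ('b, 'x, 'y) correlation = "real ^ ('b \<times> 'x \<times> 'y)"

definition correlation_of ::
  "('b \<Rightarrow> 'x \<Rightarrow> 'y \<Rightarrow> real) \<Rightarrow> ('b::finite, 'x::finite, 'y::finite) correlation" where
  "correlation_of p = (\<chi> t. case t of (b, x, y) \<Rightarrow> p b x y)"

definition pure_classical ::
  "nat \<Rightarrow> ('b::finite, 'x::finite, 'y::finite) correlation set" where
  "pure_classical d =
     {correlation_of (\<lambda>b x y. if b = D y (E x) then 1 else 0)
      | (E :: 'x \<Rightarrow> nat) (D :: 'y \<Rightarrow> nat \<Rightarrow> 'b).
        \<forall>x. E x < d}"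

definition S_C :: "nat \<Rightarrow> ('b::finite, 'x::finite, 'y::finite) correlation set" where
  "S_C d = convex hull pure_classical d"

(* The traces are real, being traces of products of two projectors; Re is only a coercion. *)
definition pure_stabilizer ::
  "nat \<Rightarrow> ('b::finite, 'x::finite, 'y::finite) correlation set" where
  "pure_stabilizer d =
     {correlation_of (\<lambda>b x y.
        \<Sum>j\<in>{j. j < d \<and> D y j = b}. Re (mat_trace (\<psi> x * stab_proj d (k y) j)))
      | (\<psi> :: 'x \<Rightarrow> complex mat) (k :: 'y \<Rightarrow> nat) (D :: 'y \<Rightarrow> nat \<Rightarrow> 'b).
        (\<forall>x. \<psi> x \<in> pure_stab_states d) \<and> (\<forall>y. k y \<in> {1..d + 1})}"

definition S_St :: "nat \<Rightarrow> ('b::finite, 'x::finite, 'y::finite) correlation set" where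
  "S_St d = convex hull pure_stabilizer d"

end

theory Submission
  imports Defs "HOL-Number_Theory.Cong"
begin

text \<open>The eigenbases are mutually unbiased, so measuring an eigenstate of one Pauli operator in
  the eigenbasis of another gives either its label or uniform noise. A d-level message that is
  masked by one shared random shift per basis reproduces exactly this; conversely a single
  eigenbasis already carries every classical strategy.\<close>

section \<open>Roots of unity\<close>

lemma cmod_omega [simp]: "cmod (omega d) = 1"
proof -
  have "omega d = cis (2 * pi / d)"
    by (simp add: omega_def cis_conv_exp mult_ac)
  then show ?thesis by simp
qed

lemma omega_nonzero [simp]: "omega d \<noteq> 0"
  using cmod_omega[of d] by force

lemma omega_mult_cnj [simp]: "omega d * cnj (omega d) = 1"
  by (simp add: complex_norm_square[symmetric])

lemma cnj_omega: "cnj (omega d) = inverse (omega d)"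
  by (metis inverse_unique omega_mult_cnj)

lemma omega_power_eq_iff:
  assumes "d > 0"
  shows "omega d ^ i = omega d ^ j \<longleftrightarrow> [i = j] (mod d)"
proof -
  have "omega d ^ n = exp (2 * of_real pi * \<i> * of_nat n / of_nat d)" for n
    by (simp add: omega_def exp_of_nat_mult[symmetric] mult_ac)
  then show ?thesis using complex_root_unity_eq[of d i j] assms by (simp add: cong_def)
qed

lemma omega_power_eq_1_iff: "d > 0 \<Longrightarrow> omega d ^ n = 1 \<longleftrightarrow> d dvd n"
  using omega_power_eq_iff[of d n 0] by (simp add: cong_0_iff)

lemma omega_power_self [simp]: "d > 0 \<Longrightarrow> omega d ^ d = 1"
  by (simp add: omega_power_eq_1_iff)

text \<open>Exponents stay natural numbers throughout: \<open>d - j\<close> stands for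
  \<open>-j\<close> modulo \<open>d\<close>, so an inverse phase is again a power of
  \<open>omega d\<close>. The case \<open>j = 0\<close> is covered, since \<open>d\<close> also
  represents 0.\<close>

lemma inverse_omega_power:
  assumes "j \<le> d" "d > 0"
  shows "inverse (omega d ^ (i * j)) = omega d ^ (i * (d - j))"
proof (rule inverse_unique)
  have "i * j + i * (d - j) = i * d"
    using assms by (simp flip: distrib_left)
  then show "omega d ^ (i * j) * omega d ^ (i * (d - j)) = 1"
    using assms by (simp add: omega_power_eq_1_iff flip: power_add)
qed

text \<open>Orthogonality of the characters of Z_d: a geometric sum whose ratio is a
  \<open>d\<close>-th root of unity vanishes unless the ratio is 1.\<close>

lemma sum_omega_powers:
  assumes "d > 0"
  shows "(\<Sum>l<d. omega d ^ (n * l)) = (if d dvd n then of_nat d else 0)"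
proof (cases "d dvd n")
  case True
  then have "omega d ^ (n * l) = 1" for l
    using assms by (simp add: omega_power_eq_1_iff)
  with True show ?thesis by simp
next
  case False
  have "(omega d ^ n) ^ d = 1"
    using assms by (simp add: omega_power_eq_1_iff flip: power_mult)
  then show ?thesis
    using False assms geometric_sum[of "omega d ^ n" d]
    by (simp add: power_mult omega_power_eq_1_iff)
qed

text \<open>The residue difference i - j, written without subtraction below zero. Its representative
  lies strictly between 0 and 2d, so \<open>d\<close> is the only multiple it can equal.\<close>

lemma dvd_add_diff_iff:
  fixes d :: nat
  assumes "i < d" "j < d"
  shows "d dvd i + (d - j) \<longleftrightarrow> i = j"
proof
  assume "d dvd i + (d - j)"
  then obtain q where q: "i + (d - j) = d * q" by blast
  moreover have "0 < i + (d - j)" "i + (d - j) < d * 2" using assms by auto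
  ultimately have "0 < d * q" "d * q < d * 2" by simp_all
  then have "q = 1" by auto
  with q assms show "i = j" by simp
qed (use assms in simp)

section \<open>Quadratic phase sums\<close>

text \<open>Expanding each squared modulus gives a double sum over i and j; after summing over the
  frequency first, character orthogonality leaves only the diagonal.\<close>

lemma parseval_omega:
  fixes f :: "nat \<Rightarrow> complex"
  assumes "d > 0"
  shows "(\<Sum>l<d. (cmod (\<Sum>i<d. f i * omega d ^ (i * l)))\<^sup>2) = d * (\<Sum>i<d. (cmod (f i))\<^sup>2)"
proof -
  have omega_product: "omega d ^ (i * l) * cnj (omega d ^ (j * l)) = omega d ^ ((i + (d - j)) * l)"
    if "j < d" for i j l
  proof -
    have "cnj (omega d ^ (j * l)) = omega d ^ ((d - j) * l)"
      using inverse_omega_power[of j d l] that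
      by (simp add: cnj_omega power_inverse mult.commute)
    then show ?thesis by (simp only: distrib_right power_add)
  qed
  have "complex_of_real (\<Sum>l<d. (cmod (\<Sum>i<d. f i * omega d ^ (i * l)))\<^sup>2)
      = (\<Sum>l<d. \<Sum>i<d. \<Sum>j<d. f i * cnj (f j) * omega d ^ ((i + (d - j)) * l))"
    unfolding of_real_sum complex_norm_square cnj_sum sum_product complex_cnj_mult
    by (intro sum.cong refl, subst omega_product[symmetric], simp, simp only: mult_ac)
  also have "\<dots> = (\<Sum>i<d. \<Sum>j<d. f i * cnj (f j) * (\<Sum>l<d. omega d ^ ((i + (d - j)) * l)))"
    by (subst sum.swap, rule sum.cong[OF refl], subst sum.swap) (simp add: sum_distrib_left)
  also have "\<dots> = (\<Sum>i<d. \<Sum>j<d. if j = i then f i * cnj (f j) * of_nat d else 0)"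
    by (intro sum.cong refl) (simp only: sum_omega_powers[OF assms] dvd_add_diff_iff lessThan_iff, simp)
  also have "\<dots> = complex_of_real (d * (\<Sum>i<d. (cmod (f i))\<^sup>2))"
    by (simp add: sum_distrib_left mult_ac flip: complex_norm_square of_real_power)
  finally show ?thesis by (simp only: of_real_eq_iff)
qed

text \<open>Shifting the summation index turns frequency l into l + b, so all Fourier coefficients
  of f have the same modulus, which Parseval then determines.\<close>

lemma cmod_quadratic_sum:
  fixes f :: "nat \<Rightarrow> complex"
  assumes "d > 0" "coprime b d" "cmod c = 1"
    and unit: "\<And>i. cmod (f i) = 1"
    and step: "\<And>i. f (Suc i) = c * omega d ^ (b * i) * f i"
    and period: "f d = f 0"
  shows "(cmod (\<Sum>i<d. f i * omega d ^ (i * l)))\<^sup>2 = d"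
proof -
  define S where "S l = (\<Sum>i<d. f i * omega d ^ (i * l))" for l
  have S_shift: "cmod (S l) = cmod (S (l + b))" for l
  proof -
    define g where "g i = f i * omega d ^ (i * l)" for i
    have "g d = g 0"
      using assms(1) by (simp add: g_def period power_mult)
    \<comment> \<open>Because \<open>g\<close> takes equal values at 0 and \<open>d\<close>, moving
      the summation window by one leaves the sum unchanged.\<close>
    then have "S l = (\<Sum>i<d. g (Suc i))"
      using sum.lessThan_Suc_shift[of g d] by (simp add: S_def g_def[symmetric])
    also have "\<dots> = c * omega d ^ l * S (l + b)"
      by (simp add: g_def S_def step sum_distrib_left power_add algebra_simps)
    finally show ?thesis by (simp add: norm_mult norm_power assms(3))
  qed
  have S_iter: "cmod (S (n * b)) = cmod (S 0)" for n
  proof (induction n)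
    case (Suc n)
    then show ?case using S_shift[of "n * b"] by (simp add: add.commute)
  qed simp
  have S_const: "cmod (S l) = cmod (S 0)" for l
  proof -
    \<comment> \<open>With \<open>x\<close> inverse to \<open>b\<close>, taking \<open>l * x\<close>
      steps of size \<open>b\<close> from frequency 0 leads to frequency \<open>l\<close> modulo
      \<open>d\<close>.\<close>
    obtain x where "[b * x = 1] (mod d)"
      using cong_solve_coprime_nat[OF assms(2)] by auto
    then have "[l * x * b = l] (mod d)"
      using cong_scalar_left[of "b * x" 1 d l] by (simp add: mult_ac)
    then have "omega d ^ (l * x * b) = omega d ^ l"
      using assms(1) by (simp add: omega_power_eq_iff)
    then have "S (l * x * b) = S l"
      unfolding S_def by (subst (1 2) mult.commute[of _ "_ :: nat"]) (simp add: power_mult)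
    with S_iter[of "l * x"] show ?thesis by simp
  qed
  have "d * (cmod (S l))\<^sup>2 = (\<Sum>m<d. (cmod (S l))\<^sup>2)"
    by simp
  also have "\<dots> = (\<Sum>m<d. (cmod (S m))\<^sup>2)"
    by (intro sum.cong refl) (metis S_const)
  also have "\<dots> = d * d"
    using parseval_omega[OF assms(1), of f] by (simp add: S_def unit)
  finally show ?thesis using assms(1) by (simp add: S_def)
qed

section \<open>Eigenbases of the Pauli operators\<close>

text \<open>The scalar prefactor of P_(1,a).\<close>

definition unit_phase :: "nat \<Rightarrow> nat \<Rightarrow> complex" where
  "unit_phase d a = (if d = 2 then \<i> ^ a else 1)"

text \<open>Coordinates, normalised to 1 at index 0, that the eigenvalue equation of P_(1,a) forces
  for eigenvalue 1. For \<open>d\<close> other than 2 this is omega^(a*i*(i-1)/2); the product form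
  avoids the division by 2.\<close>

definition quad_phase :: "nat \<Rightarrow> nat \<Rightarrow> nat \<Rightarrow> complex" where
  "quad_phase d a i = (\<Prod>m<i. unit_phase d a * omega d ^ (a * m))"

text \<open>Computational-basis amplitudes of the unit eigenvector of P_k with eigenvalue omega^j.
  For \<open>k\<close> at least 2, \<open>k - 2\<close> is the exponent of Z in P_k, and the
  eigenvalue contributes one factor omega^(-j) per index step.\<close>

definition stab_amp :: "nat \<Rightarrow> nat \<Rightarrow> nat \<Rightarrow> nat \<Rightarrow> complex" where
  "stab_amp d k j i =
     (if k = 1 then (if i = j then 1 else 0)
      else quad_phase d (k - 2) i / (omega d ^ (i * j) * sqrt d))"

lemma cmod_unit_phase [simp]: "cmod (unit_phase d a) = 1"
  by (simp add: unit_phase_def norm_power)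

lemma cmod_quad_phase [simp]: "cmod (quad_phase d a i) = 1"
  by (simp add: quad_phase_def norm_mult norm_power prod_norm[symmetric])

lemma quad_phase_0 [simp]: "quad_phase d a 0 = 1"
  by (simp add: quad_phase_def)

lemma quad_phase_Suc:
  "quad_phase d a (Suc i) = unit_phase d a * omega d ^ (a * i) * quad_phase d a i"
  by (simp add: quad_phase_def)

text \<open>The factor i in the qubit Pauli operators is what makes this hold for d = 2.\<close>

lemma quad_phase_period:
  assumes "prime d"
  shows "quad_phase d a d = 1"
proof (cases "d = 2")
  case True
  have "omega 2 = -1"
    by (simp add: omega_def)
  then have "quad_phase 2 a 2 = (\<i> * \<i>) ^ a * (-1) ^ a"
    by (simp add: numeral_2_eq_2 quad_phase_Suc unit_phase_def flip: power_mult_distrib)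
  with True show ?thesis by (simp flip: power_mult_distrib)
next
  case False
  then have "odd d" "d > 0"
    using assms primes_dvd_imp_eq two_is_prime_nat prime_gt_0_nat by blast+
  then obtain q where q: "d = Suc (2 * q)"
    by (metis oddE Suc_eq_plus1)
  \<comment> \<open>For odd \<open>d = 2q + 1\<close> the exponents 0, ..., d - 1 add up to
    \<open>q * d\<close>, a multiple of \<open>d\<close>.\<close>
  have "quad_phase d a d = omega d ^ (\<Sum>m<d. a * m)"
    using False by (simp add: quad_phase_def unit_phase_def power_sum)
  also have "(\<Sum>m<d. a * m) = a * q * d"
  proof -
    have "(\<Sum>m<Suc (2 * q). m) = q * Suc (2 * q)"
      by (induction q) (simp_all add: algebra_simps)
    then show ?thesis by (simp only: q sum_distrib_left[symmetric] mult.assoc)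
  qed
  finally show ?thesis using \<open>d > 0\<close> by (simp add: omega_power_eq_1_iff)
qed

text \<open>Mutual unbiasedness. Against the computational basis (index 1) the overlap is a single
  amplitude. Otherwise it is 1/d times a Fourier sum: a character sum within one basis, a quadratic
  sum of modulus sqrt d between two different ones.\<close>

lemma stab_amp_overlap:
  assumes "prime d" "k \<in> {1..d + 1}" "k' \<in> {1..d + 1}" "j < d" "j' < d"
  shows "(cmod (\<Sum>i<d. stab_amp d k j i * cnj (stab_amp d k' j' i)))\<^sup>2
       = (if k = k' then (if j = j' then 1 else 0) else 1 / d)"
proof -
  have d: "d > 0" using assms(1) prime_gt_0_nat by blast
  have sqrt_d: "complex_of_real (sqrt d) * complex_of_real (sqrt d) = of_nat d"
    by (simp flip: of_real_mult)
  have stab_amp1: "stab_amp d (Suc 0) j i = (if i = j then 1 else 0)" for j i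
    by (simp add: stab_amp_def)
  have amp1: "(cmod (stab_amp d k j i))\<^sup>2 = 1 / d" if "k \<noteq> 1" for k j i
    using that d by (simp add: stab_amp_def norm_divide norm_mult norm_power power_divide)
  consider "k = 1" "k' = 1" | "k = 1" "k' \<noteq> 1" | "k \<noteq> 1" "k' = 1" | "k \<noteq> 1" "k' \<noteq> 1"
    by blast
  then show ?thesis
  proof cases
    case 1
    then have "(\<Sum>i<d. stab_amp d k j i * cnj (stab_amp d k' j' i))
        = (\<Sum>i<d. if i = j then (if j = j' then 1 else 0) else 0)"
      by (intro sum.cong) (auto simp: stab_amp_def)
    with 1 assms show ?thesis by simp
  next
    case 2
    then have "(\<Sum>i<d. stab_amp d k j i * cnj (stab_amp d k' j' i))
        = (\<Sum>i<d. if i = j then cnj (stab_amp d k' j' j) else 0)"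
      by (intro sum.cong) (auto simp: stab_amp1)
    with 2 assms amp1 show ?thesis by simp
  next
    case 3
    then have "(\<Sum>i<d. stab_amp d k j i * cnj (stab_amp d k' j' i))
        = (\<Sum>i<d. if i = j' then stab_amp d k j j' else 0)"
      by (intro sum.cong) (auto simp: stab_amp1)
    with 3 assms amp1 show ?thesis by simp
  next
    case 4
    define a a' where "a = k - 2" and "a' = k' - 2"
    define f where "f i = quad_phase d a i * cnj (quad_phase d a' i)" for i
    \<comment> \<open>The frequency j' - j modulo \<open>d\<close>: the first vector contributes
      omega^(-i*j), the conjugated second one omega^(i*j').\<close>
    define l where "l = j' + (d - j)"
    have "stab_amp d k j i * cnj (stab_amp d k' j' i) = f i * omega d ^ (i * l) / d" for i
    proof -
      have "inverse (omega d ^ (i * j)) = omega d ^ (i * (d - j))"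
        using assms(4) d by (intro inverse_omega_power) auto
      moreover have "cnj (inverse (omega d ^ (i * j'))) = omega d ^ (i * j')"
        by (simp add: cnj_omega power_inverse)
      ultimately have "inverse (omega d ^ (i * j)) * cnj (inverse (omega d ^ (i * j'))) = omega d ^ (i * l)"
        by (simp only: l_def distrib_left power_add mult.commute)
      then show ?thesis
        using 4 by (simp add: stab_amp_def f_def a_def a'_def divide_inverse sqrt_d[symmetric] mult_ac)
    qed
    then have sum_eq: "(\<Sum>i<d. stab_amp d k j i * cnj (stab_amp d k' j' i))
        = (\<Sum>i<d. f i * omega d ^ (i * l)) / d"
      by (simp add: sum_divide_distrib)
    show ?thesis
    proof (cases "k = k'")
      case True
      have "f i = 1" for i
        using True by (simp add: f_def a_def a'_def complex_norm_square[symmetric])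
      then have "(\<Sum>i<d. f i * omega d ^ (i * l)) = (if j = j' then of_nat d else 0)"
        using sum_omega_powers[OF d, of l] dvd_add_diff_iff[of j' d j] assms(4,5)
        by (auto simp: l_def mult.commute)
      then show ?thesis unfolding sum_eq using True d by simp
    next
      case False
      have aa: "a < d" "a' < d" "a \<noteq> a'"
        using 4 False assms(2,3) by (auto simp: a_def a'_def)
      \<comment> \<open>The difference a - a' is a nonzero residue, hence invertible because
        \<open>d\<close> is prime. It is the step \<open>b\<close> of the quadratic sum.\<close>
      have "coprime (a + (d - a')) d"
        using prime_imp_coprime[OF assms(1), of "a + (d - a')"] dvd_add_diff_iff[of a d a'] aa
        by (auto simp: coprime_commute)
      moreover have "f (Suc i) = (unit_phase d a * cnj (unit_phase d a'))
          * omega d ^ ((a + (d - a')) * i) * f i" for i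
      proof -
        have "cnj (omega d ^ (a' * i)) = omega d ^ ((d - a') * i)"
          using inverse_omega_power[of a' d i] aa d
          by (simp add: cnj_omega power_inverse mult.commute)
        then show ?thesis
          by (simp only: f_def quad_phase_Suc complex_cnj_mult distrib_left distrib_right power_add mult_ac)
      qed
      moreover have "cmod (f i) = 1" for i
        by (simp add: f_def norm_mult)
      moreover have "f d = f 0"
        by (simp add: f_def quad_phase_period[OF assms(1)])
      ultimately have "(cmod (\<Sum>i<d. f i * omega d ^ (i * l)))\<^sup>2 = d"
        using cmod_quadratic_sum[OF d, of "a + (d - a')" "unit_phase d a * cnj (unit_phase d a')" f l]
        by (simp add: norm_mult)
      then show ?thesis using False d
        by (simp add: sum_eq norm_divide power_divide power2_eq_square)
    qed
  qed
qed

text \<open>The overlap lemma yields only the squared modulus of this sum. The sum is moreover real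
  and nonnegative, so it must be 1 itself.\<close>

lemma stab_amp_norm:
  assumes "prime d" "k \<in> {1..d + 1}" "j < d"
  shows "(\<Sum>i<d. stab_amp d k j i * cnj (stab_amp d k j i)) = 1"
proof -
  have "(\<Sum>i<d. stab_amp d k j i * cnj (stab_amp d k j i))
      = complex_of_real (\<Sum>i<d. (cmod (stab_amp d k j i))\<^sup>2)" (is "_ = of_real ?s")
    by (simp only: of_real_sum complex_norm_square)
  moreover from this have "?s\<^sup>2 = 1"
    using stab_amp_overlap[OF assms(1,2,2,3,3)] by (simp only: norm_of_real) simp
  moreover have "?s \<ge> 0" by (intro sum_nonneg) simp
  ultimately show ?thesis by (simp only: power2_eq_1_iff) auto
qed

section \<open>Coordinate action of the clock, shift and Pauli matrices\<close>

lemma clock_mat_carrier [simp]: "clock_mat d \<in> carrier_mat d d"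
  by (simp add: clock_mat_def)

lemma shift_mat_carrier [simp]: "shift_mat d \<in> carrier_mat d d"
  by (simp add: shift_mat_def)

lemma shift_mat_dim [simp]: "dim_row (shift_mat d) = d"
  by (simp add: shift_mat_def)

lemma clock_mat_mult_vec:
  assumes "v \<in> carrier_vec d" "i < d"
  shows "(clock_mat d *\<^sub>v v) $ i = omega d ^ i * v $ i"
proof -
  have "(clock_mat d *\<^sub>v v) $ i = (\<Sum>j = 0..<d. if j = i then omega d ^ i * v $ i else 0)"
    using assms by (auto simp: clock_mat_def scalar_prod_def row_def mult_delta_left)
  with assms show ?thesis by simp
qed

lemma clock_mat_pow_mult_vec:
  assumes "v \<in> carrier_vec d" "i < d"
  shows "(clock_mat d ^\<^sub>m a *\<^sub>v v) $ i = omega d ^ (a * i) * v $ i"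
  using assms(1)
proof (induction a arbitrary: v)
  case 0
  then show ?case by (simp add: clock_mat_def)
next
  case (Suc a)
  have "clock_mat d ^\<^sub>m Suc a *\<^sub>v v = clock_mat d ^\<^sub>m a *\<^sub>v (clock_mat d *\<^sub>v v)"
    using Suc.prems assoc_mult_mat_vec[OF pow_carrier_mat[OF clock_mat_carrier] clock_mat_carrier]
    by simp
  moreover have "clock_mat d *\<^sub>v v \<in> carrier_vec d"
    using Suc.prems by (metis clock_mat_carrier mult_mat_vec_carrier)
  ultimately show ?case
    using Suc assms(2) by (simp add: clock_mat_mult_vec power_add)
qed

text \<open>Reading the result at the successor index avoids a predecessor modulo \<open>d\<close>;
  \<open>basis_op_mult_vec\<close> follows the same convention.\<close>

lemma shift_mat_mult_vec:
  assumes "v \<in> carrier_vec d" "i < d"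
  shows "(shift_mat d *\<^sub>v v) $ (Suc i mod d) = v $ i"
proof -
  have inj: "Suc i mod d = Suc j mod d \<longleftrightarrow> j = i" if "j < d" for j
    using that assms(2) by (auto simp: mod_Suc split: if_splits)
  have "(shift_mat d *\<^sub>v v) $ (Suc i mod d) = (\<Sum>j = 0..<d. if j = i then v $ i else 0)"
    using assms inj by (auto simp: shift_mat_def scalar_prod_def row_def mult_delta_left)
  with assms show ?thesis by simp
qed

lemma pauli_carrier [simp]: "pauli d a \<in> carrier_mat d d"
proof -
  have "shift_mat d ^\<^sub>m m * clock_mat d ^\<^sub>m n \<in> carrier_mat d d" for m n
    by (rule mult_carrier_mat[OF pow_carrier_mat pow_carrier_mat]) simp_all
  then show ?thesis by (cases a; cases "d = 2") (simp_all add: pauli_def)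
qed

lemma basis_op_carrier [simp]: "basis_op d k \<in> carrier_mat d d"
  by (simp only: basis_op_def pauli_carrier)

lemma basis_op_dim [simp]: "dim_row (basis_op d k) = d" "dim_col (basis_op d k) = d"
  using basis_op_carrier[of d k] by (simp_all only: carrier_mat_def mem_Collect_eq)

lemma basis_op_1_mult_vec:
  assumes "v \<in> carrier_vec d" "i < d"
  shows "(basis_op d 1 *\<^sub>v v) $ i = omega d ^ i * v $ i"
proof -
  have "basis_op d 1 = clock_mat d"
    by (auto simp: basis_op_def pauli_def left_mult_one_mat[OF clock_mat_carrier] shift_mat_def clock_mat_def)
  with assms show ?thesis by (simp add: clock_mat_mult_vec)
qed

lemma basis_op_mult_vec:
  assumes "k \<noteq> 1" "v \<in> carrier_vec d" "i < d"
  shows "(basis_op d k *\<^sub>v v) $ (Suc i mod d)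
       = unit_phase d (k - 2) * omega d ^ ((k - 2) * i) * v $ i"
proof -
  define A where "A = shift_mat d * clock_mat d ^\<^sub>m (k - 2)"
  have A: "A \<in> carrier_mat d d"
    by (auto simp: A_def intro!: mult_carrier_mat[of _ d d] pow_carrier_mat)
  have "shift_mat d ^\<^sub>m 1 = shift_mat d"
    using left_mult_one_mat[OF shift_mat_carrier] by (simp add: shift_mat_def)
  then have op: "basis_op d k = unit_phase d (k - 2) \<cdot>\<^sub>m A"
    using assms(1) A by (auto simp: basis_op_def pauli_def unit_phase_def A_def)
  have smult: "(c \<cdot>\<^sub>m A *\<^sub>v v) $ n = c * (A *\<^sub>v v) $ n" if "n < d" for c n
    using A assms(2) that by (auto simp: scalar_prod_def sum_distrib_left mult_ac)
  have "(A *\<^sub>v v) $ (Suc i mod d) = (shift_mat d *\<^sub>v (clock_mat d ^\<^sub>m (k - 2) *\<^sub>v v)) $ (Suc i mod d)"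
    unfolding A_def using assms(2)
    by (simp add: assoc_mult_mat_vec[OF shift_mat_carrier pow_carrier_mat[OF clock_mat_carrier]])
  also have "\<dots> = omega d ^ ((k - 2) * i) * v $ i"
    using assms by (subst shift_mat_mult_vec)
      (auto simp: clock_mat_pow_mult_vec intro: mult_mat_vec_carrier[OF pow_carrier_mat[OF clock_mat_carrier]])
  finally show ?thesis
    using smult[OF mod_less_divisor] assms by (simp add: op del: index_mult_mat_vec)
qed

section \<open>Eigenvectors and their uniqueness up to scalars\<close>

lemma eigenvector_stab_amp:
  assumes "prime d" "k \<in> {1..d + 1}" "j < d"
  shows "eigenvector (basis_op d k) (Matrix.vec d (stab_amp d k j)) (omega d ^ j)"
proof -
  define v where "v = Matrix.vec d (stab_amp d k j)"
  have v: "v \<in> carrier_vec d" by (simp add: v_def)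
  have "v \<noteq> 0\<^sub>v d"
  proof
    assume "v = 0\<^sub>v d"
    then have "stab_amp d k j i = 0" if "i < d" for i
      using that by (metis v_def index_vec index_zero_vec(1))
    then show False using stab_amp_norm[OF assms] by simp
  qed
  moreover have "basis_op d k *\<^sub>v v = omega d ^ j \<cdot>\<^sub>v v"
  proof (cases "k = 1")
    case True
    show ?thesis
    proof (rule eq_vecI)
      fix i assume "i < dim_vec (omega d ^ j \<cdot>\<^sub>v v)"
      then have "i < d" using v by simp
      then show "(basis_op d k *\<^sub>v v) $ i = (omega d ^ j \<cdot>\<^sub>v v) $ i"
        using True v basis_op_1_mult_vec[OF v] by (auto simp: v_def stab_amp_def)
    qed (use v in simp)
  next
    case False
    have step: "(basis_op d k *\<^sub>v v) $ (Suc i mod d) = (omega d ^ j \<cdot>\<^sub>v v) $ (Suc i mod d)"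
      if "i < d" for i
    proof -
      \<comment> \<open>Only the wrap-around from \<open>d - 1\<close> to 0 needs an argument: there
        the periodicity of \<open>quad_phase\<close> closes the recursion.\<close>
      have "stab_amp d k j (Suc i mod d) = stab_amp d k j (Suc i)"
      proof (cases "Suc i = d")
        case True
        then show ?thesis
          using False prime_gt_0_nat[OF assms(1)]
          by (simp add: stab_amp_def power_mult quad_phase_period[OF assms(1)] del: power_Suc)
      qed (use that in simp)
      then show ?thesis
        using that False
        by (simp add: basis_op_mult_vec v del: index_mult_mat_vec) (simp add: v_def stab_amp_def quad_phase_Suc power_add)
    qed
    show ?thesis
    proof (rule eq_vecI)
      fix i assume "i < dim_vec (omega d ^ j \<cdot>\<^sub>v v)"
      then have i: "i < d" using v by simp
      \<comment> \<open>Every row index is a cyclic successor, so \<open>step\<close> reaches all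
        rows.\<close>
      have "i = Suc ((i + (d - 1)) mod d) mod d" "(i + (d - 1)) mod d < d"
        using i by (auto simp: mod_Suc_eq)
      with step show "(basis_op d k *\<^sub>v v) $ i = (omega d ^ j \<cdot>\<^sub>v v) $ i" by metis
    qed (use v in simp)
  qed
  ultimately show ?thesis
    using v basis_op_carrier[of d k] by (auto simp: eigenvector_def v_def)
qed

text \<open>For \<open>k = 1\<close> the eigenvalues omega^i are distinct, which kills every
  coordinate but the \<open>j\<close>-th. For other \<open>k\<close> the eigenvalue equation
  computes each coordinate from the preceding one, so the coordinate at 0 determines the
  vector.\<close>

lemma eigenvector_proportional:
  assumes "prime d" "k \<in> {1..d + 1}" "j < d"
    and "eigenvector (basis_op d k) v (omega d ^ j)"
  obtains c where "v = c \<cdot>\<^sub>v Matrix.vec d (stab_amp d k j)"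
proof -
  have d: "d > 0" using assms(1) prime_gt_0_nat by blast
  have v: "v \<in> carrier_vec d" and eig: "basis_op d k *\<^sub>v v = omega d ^ j \<cdot>\<^sub>v v"
    using assms(4) basis_op_carrier[of d k] by (auto simp: eigenvector_def)
  have "\<exists>c. \<forall>i<d. v $ i = c * stab_amp d k j i"
  proof (cases "k = 1")
    case True
    have "v $ i = 0" if "i < d" "i \<noteq> j" for i
    proof -
      have "omega d ^ i * v $ i = omega d ^ j * v $ i"
        using basis_op_1_mult_vec[OF v that(1)] eig True that v by (auto simp del: index_mult_mat_vec)
      moreover have "omega d ^ i \<noteq> omega d ^ j"
        using that assms(3) d by (simp add: omega_power_eq_iff cong_def)
      ultimately show ?thesis by simp
    qed
    with True show ?thesis
      by (intro exI[of _ "v $ j"]) (auto simp: stab_amp_def)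
  next
    case False
    \<comment> \<open>The constant is forced by index 0, where the amplitude equals 1 / sqrt
      d.\<close>
    have "v $ i = v $ 0 * sqrt d * stab_amp d k j i" if "i < d" for i
      using that
    proof (induction i)
      case 0
      then show ?case using False by (simp add: stab_amp_def)
    next
      case (Suc i)
      have "unit_phase d (k - 2) * omega d ^ ((k - 2) * i) * v $ i = omega d ^ j * v $ Suc i"
        using basis_op_mult_vec[OF False v, of i] eig Suc.prems v by simp
      then show ?case
        using Suc False by (simp add: stab_amp_def quad_phase_Suc power_add field_simps)
    qed
    then show ?thesis by blast
  qed
  then obtain c where "\<forall>i<d. v $ i = c * stab_amp d k j i" by blast
  with v have "v = c \<cdot>\<^sub>v Matrix.vec d (stab_amp d k j)"
    by (intro eq_vecI) auto
  then show thesis by (rule that)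
qed

text \<open>Resolves the definite description: two unit eigenvectors differ by a scalar of modulus
  1, and this phase cancels in \<open>ketbra\<close>.\<close>

lemma stab_proj_eq:
  assumes "prime d" "k \<in> {1..d + 1}" "j < d"
  shows "stab_proj d k j = ketbra (Matrix.vec d (stab_amp d k j))"
proof -
  define u where "u = Matrix.vec d (stab_amp d k j)"
  have uu: "u \<bullet>c u = 1"
    using stab_amp_norm[OF assms]
    by (simp add: u_def scalar_prod_def atLeast0LessThan)
  show ?thesis
    unfolding stab_proj_def u_def[symmetric]
  proof (rule the_equality)
    show "\<exists>v. eigenvector (basis_op d k) v (omega d ^ j) \<and> v \<bullet>c v = 1 \<and> ketbra u = ketbra v"
      using eigenvector_stab_amp[OF assms] uu by (auto simp: u_def)
  next
    fix M
    assume "\<exists>v. eigenvector (basis_op d k) v (omega d ^ j) \<and> v \<bullet>c v = 1 \<and> M = ketbra v"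
    then obtain v where v: "eigenvector (basis_op d k) v (omega d ^ j)" "v \<bullet>c v = 1" "M = ketbra v"
      by blast
    obtain c where c: "v = c \<cdot>\<^sub>v u"
      using eigenvector_proportional[OF assms v(1)] by (auto simp: u_def)
    have "v \<bullet>c v = c * cnj c * (u \<bullet>c u)"
      by (simp add: c scalar_prod_def sum_distrib_left mult_ac)
    then have "c * cnj c = 1" using v(2) uu by simp
    then have "c * x * (cnj c * y) = x * y" for x y
      by (metis mult.assoc mult.commute mult.left_neutral)
    then show "M = ketbra u"
      by (intro eq_matI) (auto simp: v(3) c ketbra_def)
  qed
qed

section \<open>Born probabilities of stabilizer measurements\<close>

lemma trace_ketbra_mult:
  assumes "dim_vec v = n" "dim_vec w = n"
  shows "mat_trace (ketbra v * ketbra w) = of_real ((cmod (\<Sum>i<n. v $ i * cnj (w $ i)))\<^sup>2)"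
proof -
  have "mat_trace (ketbra v * ketbra w)
      = (\<Sum>i<n. \<Sum>l<n. (v $ i * cnj (w $ i)) * (w $ l * cnj (v $ l)))"
    using assms
    by (auto simp: mat_trace_def ketbra_def scalar_prod_def atLeast0LessThan mult_ac intro!: sum.cong)
  then show ?thesis
    by (simp add: complex_norm_square sum_product mult_ac flip: of_real_power)
qed

lemma stab_proj_overlap:
  assumes "prime d" "k \<in> {1..d + 1}" "k' \<in> {1..d + 1}" "j < d" "j' < d"
  shows "Re (mat_trace (stab_proj d k j * stab_proj d k' j'))
       = (if k = k' then (if j = j' then 1 else 0) else 1 / d)"
  using stab_amp_overlap[OF assms] assms
  by (simp add: stab_proj_eq trace_ketbra_mult[where n = d])

section \<open>Simulation by shared random shifts\<close>

lemma sum_mod_shift: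
  fixes f :: "nat \<Rightarrow> 'a::comm_monoid_add"
  assumes "d > 0"
  shows "(\<Sum>t<d. f ((c + t) mod d)) = (\<Sum>m<d. f m)"
proof (rule sum.reindex_bij_betw)
  have "inj_on (\<lambda>t. (c + t) mod d) {..<d}"
  proof (rule inj_onI)
    fix s t assume "s \<in> {..<d}" "t \<in> {..<d}" "(c + s) mod d = (c + t) mod d"
    then show "s = t"
      using cong_add_lcancel_nat[of c s t d] by (simp add: cong_def)
  qed
  moreover have "(\<lambda>t. (c + t) mod d) ` {..<d} \<subseteq> {..<d}"
    using assms by auto
  ultimately show "bij_betw (\<lambda>t. (c + t) mod d) {..<d} {..<d}"
    by (simp add: bij_betw_def endo_inj_surj)
qed

text \<open>Equal labels \<open>k\<close> and \<open>k'\<close> make the two shifts cancel for every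
  \<open>r\<close>. For different labels the shifts are independent and uniform, so the decoded
  value is uniform on Z_d.\<close>

lemma sum_random_shift:
  fixes f :: "nat \<Rightarrow> real"
  assumes "d > 0" "finite K" "k \<in> K" "k' \<in> K" "j < d"
  defines "R \<equiv> PiE K (\<lambda>_. {..<d})"
  shows "(\<Sum>r\<in>R. f (((j + r k) mod d + (d - r k')) mod d)) / card R
       = (if k = k' then f j else (\<Sum>m<d. f m) / d)"
proof -
  have "finite R" "card R > 0"
    using assms(1,2) by (simp_all add: R_def finite_PiE card_PiE)
  then have R: "finite R" "card R > 0" "R \<noteq> {}" by auto
  have less: "r i < d" if "r \<in> R" "i \<in> K" for r i
    using that by (auto simp: R_def)
  have cancel: "((a + t) mod d + (d - t)) mod d = a" "((a + (d - t)) mod d + t) mod d = a"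
    if "a < d" "t \<le> d" for a t
    unfolding mod_add_left_eq using that by simp_all
  show ?thesis
  proof (cases "k = k'")
    case True
    have "((j + r k) mod d + (d - r k')) mod d = j" if "r \<in> R" for r
      using True less[OF that assms(3)] assms(5) by (simp only: cancel(1) less_imp_le)
    then show ?thesis using True R by simp
  next
    case False
    define F where "F r = f (((j + r k) mod d + (d - r k')) mod d)" for r :: "'a \<Rightarrow> nat"
    \<comment> \<open>Translating only the coordinate \<open>k\<close> permutes \<open>R\<close>,
      with inverse \<open>T (d - t)\<close>, while moving the argument of \<open>f\<close> by
      \<open>t\<close>. Averaging over \<open>t\<close> therefore replaces each term by the mean of
      \<open>f\<close>.\<close>
    define T where "T t r = r(k := (r k + t) mod d)" for t and r :: "'a \<Rightarrow> nat"
    have sum_T: "(\<Sum>r\<in>R. F (T t r)) = (\<Sum>r\<in>R. F r)" if "t < d" for t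
    proof (rule sum.reindex_bij_witness[where i = "T (d - t)" and j = "T t"])
      fix r assume r: "r \<in> R"
      then show "T t r \<in> R" "T (d - t) r \<in> R"
        using assms(1,3) by (auto simp: T_def R_def PiE_def extensional_def)
      show "T (d - t) (T t r) = r" "T t (T (d - t) r) = r"
        using less[OF r assms(3)] that
        by (simp_all only: T_def fun_upd_same fun_upd_upd cancel less_imp_le fun_upd_triv)
    qed simp
    have inner: "(\<Sum>t<d. F (T t r)) = (\<Sum>m<d. f m)" for r
    proof -
      have "F (T t r) = f ((j + r k + (d - r k') + t) mod d)" for t
        using False by (simp add: F_def T_def mod_simps add_ac)
      then show ?thesis using sum_mod_shift[OF assms(1)] by simp
    qed
    have "d * (\<Sum>r\<in>R. F r) = (\<Sum>t<d. \<Sum>r\<in>R. F (T t r))"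
      by (simp add: sum_T)
    also have "\<dots> = (\<Sum>r\<in>R. \<Sum>t<d. F (T t r))"
      by (rule sum.swap)
    also have "\<dots> = card R * (\<Sum>m<d. f m)"
      by (simp add: inner)
    finally show ?thesis
      using False R assms(1) by (simp add: F_def field_simps)
  qed
qed

text \<open>The message is encoded in the eigenbasis of P_1 and Bob always measures that basis, so
  he recovers \<open>E x\<close> with certainty.\<close>

lemma pure_classical_subset_pure_stabilizer:
  assumes "prime d"
  shows "pure_classical d \<subseteq> (pure_stabilizer d :: ('b::finite, 'x::finite, 'y::finite) correlation set)"
proof
  fix p :: "('b, 'x, 'y) correlation"
  assume "p \<in> pure_classical d"
  then obtain E D where p: "p = correlation_of (\<lambda>b x y. if b = D y (E x) then 1 else 0)"
    and E: "\<And>x. E x < d"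
    by (auto simp: pure_classical_def)
  have "(if b = D y (E x) then 1 else 0)
      = (\<Sum>j\<in>{j. j < d \<and> D y j = b}. Re (mat_trace (stab_proj d 1 (E x) * stab_proj d 1 j)))" for b x y
  proof -
    have "(\<Sum>j\<in>{j. j < d \<and> D y j = b}. Re (mat_trace (stab_proj d 1 (E x) * stab_proj d 1 j)))
        = (\<Sum>j\<in>{j. j < d \<and> D y j = b}. if j = E x then 1 else 0)"
      using E by (intro sum.cong) (auto simp: stab_proj_overlap[OF assms])
    then show ?thesis using E by auto
  qed
  then have "p = correlation_of (\<lambda>b x y. \<Sum>j\<in>{j. j < d \<and> D y j = b}.
      Re (mat_trace (stab_proj d 1 (E x) * stab_proj d ((\<lambda>_. 1) y) j)))"
    by (simp add: p)
  moreover have "\<forall>x. stab_proj d 1 (E x) \<in> pure_stab_states d"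
    using E by (force simp: pure_stab_states_def)
  ultimately show "p \<in> pure_stabilizer d"
    unfolding pure_stabilizer_def by fastforce
qed

text \<open>Holding label j in basis k, Alice sends j + r k; measuring in basis k', Bob subtracts r k'.\<close>

lemma pure_stabilizer_subset_S_C:
  assumes "prime d"
  shows "pure_stabilizer d \<subseteq> (S_C d :: ('b::finite, 'x::finite, 'y::finite) correlation set)"
proof
  fix p :: "('b, 'x, 'y) correlation"
  assume "p \<in> pure_stabilizer d"
  then obtain \<psi> k' D where
    p: "p = correlation_of (\<lambda>b x y. \<Sum>j\<in>{j. j < d \<and> D y j = b}. Re (mat_trace (\<psi> x * stab_proj d (k' y) j)))"
    and \<psi>: "\<And>x. \<psi> x \<in> pure_stab_states d" and k': "\<And>y. k' y \<in> {1..d + 1}"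
    unfolding pure_stabilizer_def by blast
  have "\<forall>x. \<exists>k j. \<psi> x = stab_proj d k j \<and> k \<in> {1..d + 1} \<and> j < d"
    using \<psi> by (auto simp: pure_stab_states_def)
  then obtain k j where \<psi>_eq: "\<And>x. \<psi> x = stab_proj d (k x) (j x)"
    and k: "\<And>x. k x \<in> {1..d + 1}" and j: "\<And>x. j x < d"
    by metis
  have d: "d > 0" using assms prime_gt_0_nat by blast
  \<comment> \<open>The values of the shared randomness: one shift for each of the d + 1 bases.
    Alice uses the entry at her own \<open>k x\<close> and Bob the entry at his \<open>k' y\<close>,
    so neither needs the other's choice.\<close>
  define R where "R = PiE {1..d + 1} (\<lambda>_. {..<d})"
  have R: "finite R" "card R > 0"
    using d by (simp_all add: R_def finite_PiE card_PiE)
  define E where "E r x = (j x + r (k x)) mod d" for r x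
  define D' where "D' r y m = D y ((m + (d - r (k' y))) mod d)" for r y m
  define q where "q r = correlation_of (\<lambda>b x y. if b = D' r y (E r x) then 1 else 0)" for r
  have "q r \<in> S_C d" for r
    unfolding S_C_def
  proof (rule hull_inc)
    show "q r \<in> pure_classical d"
      using d by (auto simp: pure_classical_def q_def E_def intro!: exI[of _ "E r"] exI[of _ "D' r"])
  qed
  then have "(\<Sum>r\<in>R. (1 / card R) *\<^sub>R q r) \<in> S_C d"
    using R by (intro convex_sum) (auto simp: S_C_def)
  moreover have "p = (\<Sum>r\<in>R. (1 / card R) *\<^sub>R q r)"
  proof -
    have "(\<Sum>j'\<in>{j'. j' < d \<and> D y j' = b}. Re (mat_trace (\<psi> x * stab_proj d (k' y) j')))
        = (\<Sum>r\<in>R. (1 / card R) * (if b = D' r y (E r x) then 1 else 0))" for b x y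
    proof -
      \<comment> \<open>The indicator that Bob's post-processing yields \<open>b\<close>. It
        vanishes off the original index set, so the sum extends to all outcomes and takes the form
        treated by \<open>sum_random_shift\<close>.\<close>
      define f :: "nat \<Rightarrow> real" where "f m = (if b = D y m then 1 else 0)" for m
      have "(\<Sum>j'\<in>{j'. j' < d \<and> D y j' = b}. Re (mat_trace (\<psi> x * stab_proj d (k' y) j')))
          = (\<Sum>j'<d. f j' * (if k x = k' y then (if j x = j' then 1 else 0) else 1 / d))"
        by (rule sum.mono_neutral_cong_left)
          (auto simp: f_def \<psi>_eq stab_proj_overlap[OF assms k k' j])
      also have "\<dots> = (if k x = k' y then f (j x) else (\<Sum>m<d. f m) / d)"
        using j[of x] by (simp add: sum_divide_distrib if_distrib[of "\<lambda>z. _ * z"] cong: if_cong)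
      also have "\<dots> = (\<Sum>r\<in>R. f (((j x + r (k x)) mod d + (d - r (k' y))) mod d)) / card R"
        using sum_random_shift[OF d _ k k' j, of f] by (simp add: R_def)
      finally show ?thesis
        by (simp add: f_def D'_def E_def sum_divide_distrib if_distrib[of "\<lambda>z. z / _"] cong: if_cong)
    qed
    then show ?thesis
      by (auto simp: Finite_Cartesian_Product.vec_eq_iff p q_def correlation_of_def)
  qed
  ultimately show "p \<in> S_C d" by simp
qed

theorem theorem1:
  fixes d :: nat
  assumes "prime d"
  shows "(S_St d :: ('b::finite, 'x::finite, 'y::finite) correlation set) = S_C d"
proof
  show "(S_St d :: ('b, 'x, 'y) correlation set) \<subseteq> S_C d"
    unfolding S_St_def
    by (rule hull_minimal[OF pure_stabilizer_subset_S_C[OF assms]]) (simp add: S_C_def)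
  show "S_C d \<subseteq> (S_St d :: ('b, 'x, 'y) correlation set)"
    unfolding S_C_def S_St_def
    by (rule hull_mono[OF pure_classical_subset_pure_stabilizer[OF assms]])
qed

end
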